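(* Let $I$ be an input with no duplicate elements and let $\mathrm{OPT}$ be the optimal number of runs on $I$ given an $M$-size buffer. Then there exists an online (randomized) algorithm $A$ with a $2M$-size buffer whose output $S$ always satisfies $\mathbb{E}[R(S)]\le\tfrac74\,\mathrm{OPT}$ and $R(S)\le 2\,\mathrm{OPT}$.
   Context: Up-down run generation problem: an input stream $I$ of elements from a totally ordered set is presented in order to an algorithm with a buffer of some fixed number of slots; the algorithm reads elements in order into the buffer and writes elements from the buffer to an output sequence $S$, each write freeing a slot that is filled by the next input element. An online algorithm decides what to write using only the buffer contents, elements already written, internal state and random bits, without knowledge of unread input. A run is a sorted or reverse-sorted sequence; $R(S)$ is the smallest $k$ such that $S$ is a concatenation of $k$ runs; $\mathrm{OPT}$ is the minimum number of runs of any output achievable on $I$ by an (offline) algorithm with buffer size $M$. *)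

theory Defs
  imports "HOL-Probability.Probability_Mass_Function"
begin

definition is_run :: "'a::linorder list \<Rightarrow> bool" where
  "is_run r \<longleftrightarrow> sorted r \<or> sorted (rev r)"

definition num_runs :: "'a::linorder list \<Rightarrow> nat" where
  "num_runs S = (LEAST k. \<exists>rs. length rs = k \<and> concat rs = S \<and> (\<forall>r\<in>set rs. is_run r))"

text \<open>
  A buffer is the list of its elements, oldest first; the unread input is a list too.
  Initially the buffer holds the first \<open>m\<close> input elements (all of them, if there are fewer).
  Each write removes one element and the next unread element, if any, is appended.
  The model makes sense for \<open>m \<ge> 1\<close>.
\<close>

definition refill :: "'a \<Rightarrow> 'a list \<Rightarrow> 'a list \<Rightarrow> 'a list" where
  "refill x B U = remove1 x B @ take 1 U"

inductive achievable_from :: "'a list \<Rightarrow> 'a list \<Rightarrow> 'a list \<Rightarrow> bool" where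
  finish: "achievable_from [] [] []"
| emit: "x \<in> set B \<Longrightarrow> achievable_from (refill x B U) (drop 1 U) S \<Longrightarrow> achievable_from B U (x # S)"

definition achievable :: "nat \<Rightarrow> 'a list \<Rightarrow> 'a list \<Rightarrow> bool" where
  "achievable m I S \<longleftrightarrow> achievable_from (take m I) (drop m I) S"

definition OPT :: "nat \<Rightarrow> 'a::linorder list \<Rightarrow> nat" where
  "OPT m I = (LEAST k. \<exists>S. achievable m I S \<and> num_runs S = k)"

text \<open>
  The decision rule receives the internal state, the buffer and the elements written so far;
  it draws at random the element to write next together with the new internal state.
  A countable state type such as \<open>nat\<close> is no restriction: the elements read so far are exactly those
  in the buffer and those written, so the rest of the history (arrival order of the written
  elements, earlier random choices) can be coded as a number.
\<close>

record ('a, 's) online_alg =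
  init_state :: 's
  decide :: "'s \<Rightarrow> 'a list \<Rightarrow> 'a list \<Rightarrow> ('a \<times> 's) pmf"

definition writes_from_buffer :: "('a, 's) online_alg \<Rightarrow> bool" where
  "writes_from_buffer A \<longleftrightarrow>
     (\<forall>s B W. B \<noteq> [] \<longrightarrow> (\<forall>(x, s') \<in> set_pmf (decide A s B W). x \<in> set B))"

text \<open>
  The first numeric argument counts the remaining writes.  The unread input \<open>U\<close> is used only
  to refill the buffer and is never passed to the decision rule.
\<close>

primrec exec :: "('a, 's) online_alg \<Rightarrow> nat \<Rightarrow> 's \<Rightarrow> 'a list \<Rightarrow> 'a list \<Rightarrow> 'a list \<Rightarrow> 'a list pmf" where
  "exec A 0 s B W U = return_pmf W"
| "exec A (Suc n) s B W U =
     bind_pmf (decide A s B W)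
       (\<lambda>(x, s'). exec A n s' (refill x B U) (W @ [x]) (drop 1 U))"

definition output_pmf :: "('a, 's) online_alg \<Rightarrow> nat \<Rightarrow> 'a list \<Rightarrow> 'a list pmf" where
  "output_pmf A m I = exec A (length I) (init_state A) (take m I) [] (drop m I)"

end

(*
  The algorithm writes maximal runs greedily, in phases.  A phase starts with a fair coin c and writes
  runs in the directions c, -c, c; a fourth run -c follows unless everything that two
  M-buffer runs in direction -c from the start of the phase could write is already written.  In every case a
  phase writes all of the next two runs of an optimal solution, so a phase costs at most 4 per 2.

  One of the two outcomes of the coin makes the fourth run superfluous.  Otherwise more than M elements of some
  M-buffer down run are skipped by the greedy up run, and more than M elements of some M-buffer up run are skipped
  by the greedy down run.  Take the element w among all of these that arrives last, say it belongs to the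
  up run.  The greedy up run writes everything that an M-buffer up run can write, so when that
  M-buffer writes w it holds w and all the M + 1 elements of the first kind, which is absurd.
  Hence the expected cost of a phase is at most (3 + 4) / 2 = 7 / 2 per 2 optimal runs.
*)

theory Submission
  imports Defs
begin

section \<open>Greedy runs against runs of a smaller buffer\<close>

definition before :: "bool \<Rightarrow> 'a::linorder \<Rightarrow> 'a \<Rightarrow> bool" where
  "before up x y \<longleftrightarrow> (if up then x < y else y < x)"

lemma before_trans: "before up x y \<Longrightarrow> before up y z \<Longrightarrow> before up x z"
  by (auto simp: before_def split: if_splits)

lemma before_asym: "before up x y \<Longrightarrow> \<not> before up y x"
  by (auto simp: before_def split: if_splits)

lemma before_total: "x \<noteq> y \<Longrightarrow> before up x y \<or> before up y x"
  by (auto simp: before_def)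

definition first_of :: "bool \<Rightarrow> 'a::linorder set \<Rightarrow> 'a" where
  "first_of up A = (if up then Min A else Max A)"

lemma first_of_in: "finite A \<Longrightarrow> A \<noteq> {} \<Longrightarrow> first_of up A \<in> A"
  by (simp add: first_of_def)

lemma first_of_before: "finite A \<Longrightarrow> y \<in> A \<Longrightarrow> y \<noteq> first_of up A \<Longrightarrow> before up (first_of up A) y"
  by (auto simp: first_of_def before_def less_le)

text \<open>
  For duplicate-free \<open>I\<close> these are the partial outputs of a buffer of size \<open>m\<close>: the \<open>i\<close>-th element
  (counting from 0) is written when exactly \<open>i + m\<close> elements have been read.
\<close>

definition feasible :: "nat \<Rightarrow> 'a list \<Rightarrow> 'a list \<Rightarrow> bool" where
  "feasible m I S \<longleftrightarrow> distinct S \<and> (\<forall>i<length S. S ! i \<in> set (take (i + m) I))"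

text \<open>
  In the last clause \<open>g ! k\<close> witnesses that \<open>e\<close>, sitting in the buffer after \<open>i\<close> writes of the run, has been
  overtaken.  For \<open>i = 0\<close> the clause says that the whole initial buffer is written.
\<close>

definition greedy_run :: "bool \<Rightarrow> nat \<Rightarrow> 'a::linorder list \<Rightarrow> 'a list \<Rightarrow> 'a list \<Rightarrow> bool" where
  "greedy_run up n I W g \<longleftrightarrow> sorted_wrt (before up) g \<and> feasible n I (W @ g) \<and>
     (\<forall>i\<le>length g. \<forall>e\<in>set (take (length W + i + n) I) - set (W @ g). \<exists>k<i. before up e (g ! k))"

text \<open>The test for the fourth run of a phase: \<open>Y\<close> is the output when the phase
  began, \<open>W\<close> the current one, \<open>R\<close> the input read. It is applied to the
  direction opposite to the first run: two runs in that direction are the only pair that three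
  alternating greedy runs may fail to serve.\<close>

definition covered :: "bool \<Rightarrow> nat \<Rightarrow> 'a::linorder list \<Rightarrow> 'a list \<Rightarrow> 'a list \<Rightarrow> bool" where
  "covered up m R Y W \<longleftrightarrow> (\<forall>x r s. feasible m R (x @ r @ s) \<longrightarrow> set x \<subseteq> set Y \<longrightarrow>
     sorted_wrt (before up) r \<longrightarrow> sorted_wrt (before up) s \<longrightarrow> set r \<union> set s \<subseteq> set W)"

lemma feasible_appendD: "feasible m I (S @ T) \<Longrightarrow> feasible m I S"
  unfolding feasible_def by (auto simp: nth_append split: if_splits)

lemma feasible_subset:
  assumes "feasible m I S" "length S \<le> Suc k" shows "set S \<subseteq> set (take (k + m) I)"
proof
  fix z assume "z \<in> set S"
  then obtain i where i: "i < length S" "z = S ! i" by (auto simp: in_set_conv_nth)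
  then have "z \<in> set (take (i + m) I)" using assms(1) by (simp add: feasible_def)
  moreover have "i + m \<le> k + m" using i assms(2) by linarith
  ultimately show "z \<in> set (take (k + m) I)" by (meson set_take_subset_set_take subsetD)
qed

lemma feasible_length_le: "distinct I \<Longrightarrow> feasible m I S \<Longrightarrow> length S \<le> length I"
  using card_mono[of "set I" "set S"] feasible_subset[of m I S "length S"]
  by (auto simp: distinct_card feasible_def dest: in_set_takeD)

text \<open>When \<open>r ! j\<close> is about to be written, all of \<open>Z\<close> lies in the
  buffer of size \<open>m\<close> beside \<open>r ! j\<close> itself, which leaves at most
  \<open>m - 1\<close> slots for \<open>Z\<close>.\<close>

lemma card_before_write:
  assumes "feasible m I (x @ r)" "j < length r"
    and "Z \<subseteq> set (take (length x + j + m) I)" "Z \<inter> set (x @ take (Suc j) r) = {}"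
  shows "card Z < m"
proof -
  have d: "distinct (x @ r)" and f: "feasible m I (x @ take (Suc j) r)"
    using assms(1) feasible_appendD[of m I "x @ take (Suc j) r" "drop (Suc j) r"]
    by (auto simp: feasible_def)
  have "distinct (x @ take (Suc j) r)" using f by (simp add: feasible_def)
  then have c: "card (set (x @ take (Suc j) r)) = length x + Suc j"
    using assms(2) by (subst distinct_card) auto
  have "set (x @ take (Suc j) r) \<subseteq> set (take (length x + j + m) I)"
    using feasible_subset[OF f, of "length x + j"] by simp
  then have "card (Z \<union> set (x @ take (Suc j) r)) \<le> card (set (take (length x + j + m) I))"
    using assms(3) by (intro card_mono) auto
  also have "\<dots> \<le> length x + j + m"
    by (metis card_length length_take min.bounded_iff)
  finally have "card (Z \<union> set (x @ take (Suc j) r)) \<le> length x + j + m" .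
  moreover have "card (Z \<union> set (x @ take (Suc j) r)) = card Z + (length x + Suc j)"
    using assms(3,4) c by (subst card_Un_disjoint) (auto intro: finite_subset)
  ultimately show ?thesis by simp
qed

text \<open>
  Look at the first element \<open>e\<close> of \<open>r\<close> that the greedy run misses, and at the greedy buffer when the run passes \<open>e\<close>:
  \<open>e\<close> is still unread, so the \<open>m\<close>-buffer has written more than \<open>n - m\<close> of the \<open>n\<close> buffered elements.
  One of these belongs to \<open>r\<close>, hence precedes \<open>e\<close> in \<open>r\<close>, and the greedy run writes it after passing \<open>e\<close>.
\<close>

lemma greedy_run_covers:
  assumes I: "distinct I" and fx: "feasible m I (x @ r)" and sr: "sorted_wrt (before up) r"
    and g: "greedy_run up n I y g" and cxy: "card (set x - set y) + m \<le> n"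
  shows "set r \<subseteq> set (y @ g)"
proof (rule ccontr)
  assume "\<not> set r \<subseteq> set (y @ g)"
  then have "\<exists>j. j < length r \<and> r ! j \<notin> set (y @ g)" by (metis in_set_conv_nth subsetI)
  define j where "j = (LEAST j. j < length r \<and> r ! j \<notin> set (y @ g))"
  have j: "j < length r" "r ! j \<notin> set (y @ g)"
    using LeastI_ex[OF \<open>\<exists>j. _\<close>] unfolding j_def by blast+
  have jmin: "r ! k \<in> set (y @ g)" if "k < j" for k
    using not_less_Least[of k "\<lambda>j. j < length r \<and> r ! j \<notin> set (y @ g)"] that j unfolding j_def[symmetric] by auto
  define e where "e = r ! j"
  define i where "i = length (takeWhile (\<lambda>z. before up z e) g)"
  have sg: "sorted_wrt (before up) g" and fg: "feasible n I (y @ g)" using g by (auto simp: greedy_run_def)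
  have il: "i \<le> length g" unfolding i_def by (rule length_takeWhile_le)
  have lo: "before up (g ! k) e" if "k < i" for k
    using that unfolding i_def by (metis nth_mem set_takeWhileD takeWhile_nth)
  have hi: "before up e (g ! k)" if "i \<le> k" "k < length g" for k
  proof -
    have "\<not> before up (g ! i) e" using that unfolding i_def by (intro nth_length_takeWhile) auto
    then have "\<not> before up (g ! k) e"
      using that sg by (metis before_trans le_neq_implies_less sorted_wrt_nth_less)
    moreover have "g ! k \<noteq> e" using j(2) that(2) unfolding e_def by (metis UnCI nth_mem set_append)
    ultimately show ?thesis using before_total by blast
  qed
  define T where "T = set (take (length y + i + n) I)"
  have eT: "e \<notin> T"
  proof
    assume "e \<in> T"
    then have "\<exists>k<i. before up e (g ! k)"
      using g il j unfolding greedy_run_def T_def e_def by auto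
    then show False using lo before_asym by blast
  qed
  have eQ: "e \<in> set (take (length x + j + m) I)"
  proof -
    have "(x @ r) ! (length x + j) \<in> set (take (length x + j + m) I)"
      using fx j unfolding feasible_def by (metis length_append nat_add_left_cancel_less)
    then show ?thesis by (simp add: e_def)
  qed
  have lt: "length y + i + n < length x + j + m"
    using eT eQ set_take_subset_set_take[of "length x + j + m" "length y + i + n" I] unfolding T_def by (meson in_mono not_less)
  \<comment> \<open>\<open>e\<close> arrives only after this prefix, so the prefix is not cut short
    by the end of the input and its size is exact.\<close>
  have "length y + i + n \<le> length I"
    using eT eQ unfolding T_def by (metis in_set_takeD nat_le_linear take_all)
  then have cT: "card T = length y + i + n" unfolding T_def using I by (simp add: distinct_card)
  let ?P = "set (x @ take j r)"
  have TP: "card (T - ?P) < m"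
  proof (rule card_before_write[OF fx j(1)])
    show "T - ?P \<subseteq> set (take (length x + j + m) I)"
      using lt set_take_subset_set_take[of "length y + i + n" "length x + j + m" I] unfolding T_def by auto
    show "(T - ?P) \<inter> set (x @ take (Suc j) r) = {}"
      using eT j by (auto simp: take_Suc_conv_app_nth e_def)
  qed
  let ?H = "set (y @ take i g)"
  have "card ?H \<le> length y + i" using il by (metis card_length length_append length_take min.absorb2)
  then have nT: "n \<le> card (T - ?H)"
    using cT diff_card_le_card_Diff[of ?H T] by auto
  have "T - ?H \<subseteq> (T - ?P) \<union> (set x - set y)"
  proof
    fix z assume z: "z \<in> T - ?H"
    show "z \<in> (T - ?P) \<union> (set x - set y)"
    proof (rule ccontr)
      assume "z \<notin> (T - ?P) \<union> (set x - set y)"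
      then have "z \<in> set (take j r)" using z by auto
      then obtain k where k: "k < j" "z = r ! k" using j by (auto simp: in_set_conv_nth)
      then have "z \<in> set g" using jmin[of k] z by auto
      then obtain k' where k': "k' < length g" "z = g ! k'" by (auto simp: in_set_conv_nth)
      have "i \<le> k'"
      proof (rule ccontr)
        assume "\<not> i \<le> k'"
        then have "z \<in> set (take i g)" using k' by (auto simp: in_set_conv_nth)
        then show False using z by auto
      qed
      then have "before up e z" using hi k' by auto
      moreover have "before up z e" unfolding e_def k(2) using sr k(1) j(1) by (simp add: sorted_wrt_nth_less)
      ultimately show False using before_asym by blast
    qed
  qed
  then have "card (T - ?H) \<le> card (T - ?P) + card (set x - set y)"
    by (intro order.trans[OF card_mono card_Un_le]) (simp_all add: T_def)
  then show False using nT TP cxy by simp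
qed

section \<open>Lucky outcomes of the coin\<close>

text \<open>The bound \<open>m\<close> is the deficit that \<open>greedy_run_covers\<close>
  tolerates for buffers of sizes \<open>m\<close> and \<open>2 * m\<close>.\<close>

definition lucky :: "bool \<Rightarrow> nat \<Rightarrow> 'a::linorder list \<Rightarrow> 'a list \<Rightarrow> 'a list \<Rightarrow> bool" where
  "lucky up m I y g \<longleftrightarrow> (\<forall>x r. feasible m I (x @ r) \<longrightarrow> set x \<subseteq> set y \<longrightarrow>
     sorted_wrt (before (\<not> up)) r \<longrightarrow> card (set r - set (y @ g)) \<le> m)"

text \<open>When \<open>w\<close> is written, all of \<open>Z\<close> has been read and none of it
  written, so a buffer of size \<open>m\<close> would hold \<open>w\<close> and at least
  \<open>m\<close> further elements.\<close>

lemma late_write_contra: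
  assumes "feasible m I (x @ r)" "w \<in> set r" "Z \<inter> set (x @ r) = {}" "m \<le> card Z"
    and "\<And>k. w \<in> set (take k I) \<Longrightarrow> Z \<subseteq> set (take k I)"
  shows False
proof -
  obtain j where j: "j < length r" "w = r ! j" using assms(2) by (auto simp: in_set_conv_nth)
  have "(x @ r) ! (length x + j) \<in> set (take (length x + j + m) I)"
    using assms(1) j unfolding feasible_def by (metis length_append nat_add_left_cancel_less)
  then have "Z \<subseteq> set (take (length x + j + m) I)" using assms(5) j by simp
  moreover have "Z \<inter> set (x @ take (Suc j) r) = {}" using assms(3) by (auto dest: in_set_takeD)
  ultimately have "card Z < m" using card_before_write[OF assms(1) j(1)] by blast
  then show False using assms(4) by simp
qed

text \<open>Two counterexamples \<open>r\<close> and \<open>r'\<close> are played off against each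
  other: each greedy run covers the run of its own direction, so the elements \<open>Z\<close> of
  \<open>r\<close> missed by \<open>g\<close> do not occur in \<open>r'\<close>, and the elements
  \<open>Z'\<close> of \<open>r'\<close> missed by \<open>h\<close> do not occur in
  \<open>r\<close>.\<close>

lemma lucky_either:
  assumes I: "distinct I" and g: "greedy_run up (2 * m) I y g" and h: "greedy_run (\<not> up) (2 * m) I y h"
  shows "lucky up m I y g \<or> lucky (\<not> up) m I y h"
proof (rule ccontr)
  assume "\<not> ?thesis"
  then obtain x r x' r' where 
    r: "feasible m I (x @ r)" "set x \<subseteq> set y" "sorted_wrt (before (\<not> up)) r" "m < card (set r - set (y @ g))" and
    r': "feasible m I (x' @ r')" "set x' \<subseteq> set y" "sorted_wrt (before up) r'" "m < card (set r' - set (y @ h))"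
    unfolding lucky_def by (auto simp: not_le)
  have rh: "set r \<subseteq> set (y @ h)"
    by (rule greedy_run_covers[OF I r(1,3) h]) (use r(2) in \<open>simp add: Diff_eq_empty_iff[THEN iffD2]\<close>)
  have rg: "set r' \<subseteq> set (y @ g)"
    by (rule greedy_run_covers[OF I r'(1,3) g]) (use r'(2) in \<open>simp add: Diff_eq_empty_iff[THEN iffD2]\<close>)
  define Z where "Z = set r - set (y @ g)"
  define Z' where "Z' = set r' - set (y @ h)"
  have sub: "Z \<union> Z' \<subseteq> set I"
    using feasible_subset[OF r(1), of "length (x @ r)"] feasible_subset[OF r'(1), of "length (x' @ r')"]
    by (auto simp: Z_def Z'_def dest!: in_set_takeD)
  \<comment> \<open>The shortest prefix containing both sets ends with the element \<open>w\<close>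
    that arrives last.\<close>
  define k where "k = (LEAST k. Z \<union> Z' \<subseteq> set (take k I))"
  have "Z \<union> Z' \<subseteq> set (take (length I) I)" using sub by simp
  then have k: "Z \<union> Z' \<subseteq> set (take k I)" unfolding k_def by (rule LeastI)
  have kmin: "k \<le> k'" if "Z \<union> Z' \<subseteq> set (take k' I)" for k' unfolding k_def using that by (rule Least_le)
  have "Z \<noteq> {}" using r(4) unfolding Z_def by (metis card.empty not_less_zero)
  then have "k \<noteq> 0" using k by (intro notI) auto
  then have "\<not> Z \<union> Z' \<subseteq> set (take (k - 1) I)" using kmin[of "k - 1"] by auto
  then obtain w where w: "w \<in> Z \<union> Z'" "w \<notin> set (take (k - 1) I)" by blast
  have late: "Z \<union> Z' \<subseteq> set (take k' I)" if "w \<in> set (take k' I)" for k'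
  proof -
    have "\<not> k' \<le> k - 1" using that w(2) set_take_subset_set_take[of k' "k - 1" I] by blast
    then have "k \<le> k'" by simp
    then show ?thesis using k set_take_subset_set_take[of k k' I] by blast
  qed
  show False
  proof (cases "w \<in> Z'")
    case True
    show False
    proof (rule late_write_contra[OF r'(1)])
      show "w \<in> set r'" using True by (simp add: Z'_def)
      show "Z \<inter> set (x' @ r') = {}" using rg r'(2) by (auto simp: Z_def)
      show "m \<le> card Z" using r(4) by (simp add: Z_def)
      show "Z \<subseteq> set (take k' I)" if "w \<in> set (take k' I)" for k' using late[OF that] by simp
    qed
  next
    case False
    show False
    proof (rule late_write_contra[OF r(1)])
      show "w \<in> set r" using False w(1) by (simp add: Z_def)
      show "Z' \<inter> set (x @ r) = {}" using rh r(2) by (auto simp: Z'_def)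
      show "m \<le> card Z'" using r'(4) by (simp add: Z'_def)
      show "Z' \<subseteq> set (take k' I)" if "w \<in> set (take k' I)" for k' using late[OF that] by simp
    qed
  qed
qed

text \<open>The single run \<open>g2\<close> serves both runs: at its start nothing of
  \<open>x\<close> is missing, and of \<open>x @ r\<close> at most \<open>m\<close> elements are
  missing by \<open>lucky\<close>, a deficit that the surplus of \<open>2 * m - m\<close> slots
  absorbs.\<close>

lemma lucky_covered:
  assumes I: "distinct I" and g1: "greedy_run up (2 * m) I y g1" and g2: "greedy_run (\<not> up) (2 * m) I (y @ g1) g2"
    and l: "lucky up m I y g1"
  shows "covered (\<not> up) m I y (y @ g1 @ g2)"
  unfolding covered_def
proof (intro allI impI)
  fix x r s assume f: "feasible m I (x @ r @ s)" and x: "set x \<subseteq> set y"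
    and s: "sorted_wrt (before (\<not> up)) r" "sorted_wrt (before (\<not> up)) s"
  have fr: "feasible m I (x @ r)" using f feasible_appendD[of m I "x @ r" s] by simp
  have 0: "set x - set (y @ g1) = {}" using x by auto
  have "set r \<subseteq> set ((y @ g1) @ g2)"
    by (rule greedy_run_covers[OF I fr s(1) g2]) (simp only: 0, simp)
  moreover have "set s \<subseteq> set ((y @ g1) @ g2)"
  proof (rule greedy_run_covers[OF I _ s(2) g2])
    show "feasible m I ((x @ r) @ s)" using f by simp
    have "set (x @ r) - set (y @ g1) = set r - set (y @ g1)" using x by auto
    then show "card (set (x @ r) - set (y @ g1)) + m \<le> 2 * m" using l fr x s unfolding lucky_def by auto
  qed
  ultimately show "set r \<union> set s \<subseteq> set (y @ g1 @ g2)" by auto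
qed

section \<open>Coverage is decided by the input already read\<close>

lemma feasible_cong_take:
  assumes "feasible m I S" "length S \<le> Suc k" "k + m \<le> p" shows "feasible m (take p I) S"
  using assms by (auto simp: feasible_def min_def)

lemma feasible_take: "feasible m (take p I) S \<Longrightarrow> feasible m I S"
  unfolding feasible_def by (metis in_set_takeD take_take min.commute)

lemma covered_takeI: "covered up m I Y W \<Longrightarrow> covered up m (take p I) Y W"
  unfolding covered_def using feasible_take by blast

text \<open>Makes the test online. As long as the part of \<open>r @ s\<close> reached so far lies
  in \<open>W\<close>, the schedule has made at most \<open>length W\<close> writes, so its next
  write needs only the known prefix of the input; hence the induction over prefixes of
  \<open>r @ s\<close>.\<close>

lemma covered_takeD:
  assumes c: "covered up m (take (length W + n) I) Y W" and "m \<le> n" "set Y \<subseteq> set W"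
  shows "covered up m I Y W"
  unfolding covered_def
proof (intro allI impI)
  fix x r s assume f: "feasible m I (x @ r @ s)" and x: "set x \<subseteq> set Y"
    and s: "sorted_wrt (before up) r" "sorted_wrt (before up) s"
  have "set (take t (r @ s)) \<subseteq> set W" for t
  proof (induction t)
    case (Suc t)
    have "distinct (x @ take t (r @ s))" using f unfolding feasible_def by (metis append_take_drop_id distinct_append append.assoc)
    then have "length (x @ take t (r @ s)) = card (set (x @ take t (r @ s)))" by (simp only: distinct_card)
    also have "\<dots> \<le> card (set W)" using x assms(3) Suc by (intro card_mono) auto
    also have "\<dots> \<le> length W" by (rule card_length)
    finally have "length (x @ take (Suc t) (r @ s)) \<le> Suc (length W)" by simp
    moreover have "feasible m I (x @ take (Suc t) (r @ s))"
      using f feasible_appendD[of m I "x @ take (Suc t) (r @ s)" "drop (Suc t) (r @ s)"] by (simp only: append_assoc append_take_drop_id)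
    ultimately have "feasible m (take (length W + n) I) (x @ take (Suc t) (r @ s))"
      using assms(2) by (intro feasible_cong_take) auto
    then have "feasible m (take (length W + n) I) (x @ take (Suc t) r @ take (Suc t - length r) s)" by simp
    then have "set (take (Suc t) r) \<union> set (take (Suc t - length r) s) \<subseteq> set W"
      using c x s sorted_wrt_take unfolding covered_def by blast
    then show ?case by simp
  qed simp
  from this[of "length (r @ s)"] show "set r \<union> set s \<subseteq> set W" by simp
qed

section \<open>Algorithms that know the arrival order\<close>

definition buffer :: "nat \<Rightarrow> 'a list \<Rightarrow> 'a list \<Rightarrow> 'a list" where
  "buffer n I W = filter (\<lambda>x. x \<notin> set W) (take (length W + n) I)"

definition arrival :: "'a list \<Rightarrow> 'a \<Rightarrow> nat" where
  "arrival I x = length (takeWhile (\<lambda>z. z \<noteq> x) I)"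

text \<open>
  The arrival indices \<open>ts\<close> of the written elements are the only part of the history that has to be
  stored in the state: together with the output and the buffer they determine the input read so far.
\<close>

definition history :: "nat list \<Rightarrow> 'a list \<Rightarrow> 'a list \<Rightarrow> 'a list" where
  "history ts W B = (SOME R. length R = length W + length B \<and> (\<forall>t\<in>set ts. t < length R) \<and>
     map ((!) R) ts = W \<and> nths R (- set ts) = B)"

lemma arrival_take: "x \<in> set (take k I) \<Longrightarrow> arrival (take k I) x = arrival I x"
  using takeWhile_append1[of x "take k I" "\<lambda>z. z \<noteq> x" "drop k I"] by (simp add: arrival_def)

lemma arrival_less: "x \<in> set I \<Longrightarrow> arrival I x < length I"
  unfolding arrival_def by (induction I) auto

lemma nth_arrival: "x \<in> set I \<Longrightarrow> I ! arrival I x = x"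
  using arrival_less[of x I] nth_length_takeWhile[of "\<lambda>z. z \<noteq> x" I] by (simp add: arrival_def)

lemma nths_cong: "(\<And>i. i < length xs \<Longrightarrow> i \<in> A \<longleftrightarrow> i \<in> B) \<Longrightarrow> nths xs A = nths xs B"
  unfolding nths_def by (intro arg_cong[of _ _ "map fst"] filter_cong) (auto simp: set_zip)

text \<open>Gives uniqueness of the reconstructed history: \<open>A\<close> will be the positions
  not yet written, and all other positions are fixed by the output.\<close>

lemma nths_eq_imp_eq:
  assumes "length xs = length ys" "nths xs A = nths ys A" "\<And>i. i < length xs \<Longrightarrow> i \<notin> A \<Longrightarrow> xs ! i = ys ! i"
  shows "xs = ys"
  using assms
proof (induction xs ys arbitrary: A rule: list_induct2)
  case (Cons x xs y ys)
  have "x = y" using Cons.prems(1) Cons.prems(2)[of 0] by (auto simp: nths_Cons split: if_splits)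
  moreover have "xs = ys"
    by (rule Cons.IH[of "{j. Suc j \<in> A}"])
      (use Cons.prems(1) Cons.prems(2)[of "Suc _"] in \<open>auto simp: nths_Cons split: if_splits\<close>)
  ultimately show ?case by simp
qed simp

lemma feasible_set: "feasible n I W \<Longrightarrow> set W \<subseteq> set (take (length W + n) I)"
  using feasible_subset[of n I W "length W"] by simp

lemma length_buffer:
  assumes "distinct I" "feasible n I W"
  shows "length (take (length W + n) I) = length W + length (buffer n I W)"
proof -
  let ?R = "take (length W + n) I"
  have d: "distinct ?R" "distinct W" "set W \<subseteq> set ?R" using assms feasible_set by (auto simp: feasible_def)
  have "length (buffer n I W) = card (set ?R - set W)"
    unfolding buffer_def using d(1) by (subst distinct_card[symmetric]) (auto intro: arg_cong[of _ _ card])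
  also have "\<dots> = length ?R - length W"
    using d by (subst card_Diff_subset) (simp_all only: distinct_card finite_set)
  finally show ?thesis using card_mono[OF _ d(3)] d by (simp only: distinct_card finite_set) simp
qed

text \<open>The true prefix satisfies the specification of \<open>history\<close>, and uniqueness
  forces the choice operator to return it. Absence of duplicates makes an index occur in the stored
  list exactly when its element has been written.\<close>

lemma history_arrival:
  assumes I: "distinct I" and W: "feasible n I W"
  shows "history (map (arrival I) W) W (buffer n I W) = take (length W + n) I"
proof -
  let ?R = "take (length W + n) I" and ?ts = "map (arrival I) W"
  have d: "distinct ?R" using I by simp
  have sub: "x \<in> set ?R" if "x \<in> set W" for x using that feasible_set[OF W] by auto
  have ar: "arrival I x < length ?R" "?R ! arrival I x = x" if "x \<in> set W" for x
    using arrival_less[OF sub[OF that]] nth_arrival[OF sub[OF that]] arrival_take[OF sub[OF that]] by simp_all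
  have iff: "i \<in> set ?ts \<longleftrightarrow> ?R ! i \<in> set W" if "i < length ?R" for i
  proof
    assume "i \<in> set ?ts" then show "?R ! i \<in> set W" using ar by auto
  next
    assume w: "?R ! i \<in> set W"
    have "i = arrival I (?R ! i)" using nth_eq_iff_index_eq[OF d that ar(1)[OF w]] ar(2)[OF w] by simp
    then show "i \<in> set ?ts" using w unfolding set_map by (rule image_eqI)
  qed
  have "buffer n I W = nths ?R {i. i < length ?R \<and> ?R ! i \<notin> set W}"
    unfolding buffer_def by (rule filter_eq_nths)
  also have "\<dots> = nths ?R (- set ?ts)" using iff by (intro nths_cong) auto
  finally have B: "nths ?R (- set ?ts) = buffer n I W" ..
  have M: "map ((!) ?R) ?ts = W" using ar(2) by (simp add: map_idI)
  show ?thesis unfolding history_def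
  proof (rule some_equality)
    show "length ?R = length W + length (buffer n I W) \<and> (\<forall>t\<in>set ?ts. t < length ?R) \<and>
        map ((!) ?R) ?ts = W \<and> nths ?R (- set ?ts) = buffer n I W"
    proof (intro conjI)
      show "\<forall>t\<in>set ?ts. t < length ?R" using ar(1) by auto
    qed (fact length_buffer[OF I W] M B)+
  next
    fix R assume R: "length R = length W + length (buffer n I W) \<and> (\<forall>t\<in>set ?ts. t < length R) \<and>
        map ((!) R) ?ts = W \<and> nths R (- set ?ts) = buffer n I W"
    show "R = ?R"
    proof (rule nths_eq_imp_eq)
      show "length R = length ?R" using R length_buffer[OF I W] by simp
      show "nths R (- set ?ts) = nths ?R (- set ?ts)" using R B by simp
      fix i assume "i \<notin> - set ?ts"
      then have "i \<in> set ?ts" by (simp only: Compl_iff not_not)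
      have "map ((!) R) ?ts = map ((!) ?R) ?ts" using R M by (simp only:)
      then have "\<forall>t\<in>set ?ts. R ! t = ?R ! t" unfolding map_eq_conv .
      then show "R ! i = ?R ! i" using \<open>i \<in> set ?ts\<close> by (rule bspec)
    qed
  qed
qed

lemma buffer_eq_Nil_iff:
  assumes "distinct I" "feasible n I W" "n \<ge> 1"
  shows "buffer n I W = [] \<longleftrightarrow> length W = length I"
  using length_buffer[OF assms(1,2)] feasible_length_le[OF assms(1,2)] assms(3) by (auto simp: min_def split: if_splits)

lemma feasible_snoc: "feasible n I W \<Longrightarrow> x \<in> set (buffer n I W) \<Longrightarrow> feasible n I (W @ [x])"
  by (auto simp: feasible_def buffer_def nth_append less_Suc_eq)

text \<open>The operational refill agrees with the closed formula: the element read next survives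
  the filter, since without duplicates it cannot be among the elements already read.\<close>

lemma refill_buffer:
  assumes "distinct I" "feasible n I W" "x \<in> set (buffer n I W)"
  shows "refill x (buffer n I W) (drop (length W + n) I) = buffer n I (W @ [x])"
proof -
  let ?k = "length W + n"
  have d: "distinct (buffer n I W)" using assms(1) by (simp add: buffer_def)
  have rm: "remove1 x (buffer n I W) = filter (\<lambda>z. z \<notin> set (W @ [x])) (take ?k I)"
    using distinct_remove1_removeAll[OF d, of x] unfolding buffer_def removeAll_filter_not_eq filter_filter
    by (auto intro: filter_cong)
  show ?thesis
  proof (cases "?k < length I")
    case True
    have new: "I ! ?k \<notin> set (take ?k I)"
      using assms(1) True by (auto simp: in_set_conv_nth nth_eq_iff_index_eq)
    then have "I ! ?k \<notin> set (W @ [x])" using feasible_set[OF assms(2)] assms(3) by (auto simp: buffer_def)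
    then show ?thesis
      unfolding refill_def rm using True
      by (simp add: buffer_def[of _ _ "W @ [x]"] take_Suc_conv_app_nth hd_drop_conv_nth )
  next
    case False
    then show ?thesis unfolding refill_def rm by (simp add: buffer_def)
  qed
qed

text \<open>
  \<open>None\<close>: a new phase begins.  \<open>Some (k, j, up)\<close>: the phase began after \<open>k\<close> writes, \<open>j\<close> of its runs are
  complete, and the current run has direction \<open>up\<close>.
\<close>

type_synonym phase = "(nat \<times> nat \<times> bool) option"

text \<open>Fits a rule \<open>act\<close> that may inspect the whole prefix read so far to the
  online interface; the arrival indices and the phase are coded in one number.\<close>

definition history_alg :: "(phase \<Rightarrow> 'a list \<Rightarrow> 'a list \<Rightarrow> 'a list \<Rightarrow> ('a \<times> phase) pmf) \<Rightarrow> ('a, nat) online_alg" where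
  "history_alg act = \<lparr>init_state = to_nat ([] :: nat list, None :: phase),
     decide = \<lambda>s B W. let (ts :: nat list, c) = from_nat s; R = history ts W B
       in map_pmf (\<lambda>(x, c'). (x, to_nat (ts @ [arrival R x], c'))) (act c R B W)\<rparr>"

text \<open>The state is a function of \<open>W\<close> and \<open>c\<close>, so the execution can
  be studied as a process on these two alone.\<close>

definition play :: "(phase \<Rightarrow> 'a list \<Rightarrow> 'a list \<Rightarrow> 'a list \<Rightarrow> ('a \<times> phase) pmf) \<Rightarrow> nat \<Rightarrow> 'a list \<Rightarrow> 'a list \<Rightarrow> phase \<Rightarrow> 'a list pmf" where
  "play act n I W c = exec (history_alg act) (length I - length W) (to_nat (map (arrival I) W, c))
     (buffer n I W) W (drop (length W + n) I)"

lemma play_done: "length I \<le> length W \<Longrightarrow> play act n I W c = return_pmf W"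
  by (simp add: play_def)

lemma play_step:
  assumes I: "distinct I" and W: "feasible n I W" "length W < length I"
    and act: "\<And>x c'. (x, c') \<in> set_pmf (act c (take (length W + n) I) (buffer n I W) W) \<Longrightarrow> x \<in> set (buffer n I W)"
  shows "play act n I W c =
    act c (take (length W + n) I) (buffer n I W) W \<bind> (\<lambda>(x, c'). play act n I (W @ [x]) c')"
proof -
  let ?A = "history_alg act" and ?R = "take (length W + n) I" and ?B = "buffer n I W"
  have l: "length I - length W = Suc (length I - Suc (length W))" using W(2) by simp
  have dec: "decide ?A (to_nat (map (arrival I) W, c)) ?B W =
    map_pmf (\<lambda>(x, c'). (x, to_nat (map (arrival I) W @ [arrival ?R x], c'))) (act c ?R ?B W)"
    by (simp add: history_alg_def history_arrival[OF I W(1)] Let_def)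
  have "exec ?A (length I - Suc (length W)) (to_nat (map (arrival I) W @ [arrival ?R x], c'))
      (refill x ?B (drop (length W + n) I)) (W @ [x]) (drop 1 (drop (length W + n) I)) = play act n I (W @ [x]) c'"
    if "(x, c') \<in> set_pmf (act c ?R ?B W)" for x c'
  proof -
    have x: "x \<in> set ?B" using act that by blast
    then have "arrival ?R x = arrival I x" by (intro arrival_take) (simp add: buffer_def)
    then show ?thesis by (simp add: play_def refill_buffer[OF I W(1) x])
  qed
  then show ?thesis
    unfolding play_def[of act n I W] l exec.simps dec bind_map_pmf
    by (intro bind_pmf_cong refl) (clarsimp split: prod.split)
qed

lemma output_pmf_history_alg: "output_pmf (history_alg act) n I = play act n I [] None"
  by (simp add: output_pmf_def play_def buffer_def history_alg_def)


section \<open>The coin-tossing up-down algorithm\<close>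

definition later :: "bool \<Rightarrow> 'a::linorder list \<Rightarrow> 'a list \<Rightarrow> 'a set" where
  "later up B W = {b \<in> set B. before up (last W) b}"

definition coin_start :: "'a::linorder list \<Rightarrow> 'a list \<Rightarrow> ('a \<times> phase) pmf" where
  "coin_start B W = map_pmf (\<lambda>up. (first_of up (set B), Some (length W, 0, up))) (bernoulli_pmf (1 / 2))"

text \<open>While the current run can be continued, \<open>c\<close> stays as it is.
  \<open>j\<close> excludes the current run, so \<open>j < 2\<close> starts the second or third run
  and \<open>j = 2\<close> decides about the fourth; \<open>take k W\<close> is the output when the
  phase began.\<close>

definition up_down :: "nat \<Rightarrow> phase \<Rightarrow> 'a::linorder list \<Rightarrow> 'a list \<Rightarrow> 'a list \<Rightarrow> ('a \<times> phase) pmf" where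
  "up_down m c R B W = (case c of
     None \<Rightarrow> coin_start B W
   | Some (k, j, up) \<Rightarrow>
       if later up B W \<noteq> {} then return_pmf (first_of up (later up B W), c)
       else if j < 2 \<or> j = 2 \<and> \<not> covered (\<not> up) m R (take k W) W
       then return_pmf (first_of (\<not> up) (set B), Some (k, Suc j, \<not> up))
       else coin_start B W)"

lemma up_down_in_buffer:
  assumes "(x, c') \<in> set_pmf (up_down m c R B W)" "B \<noteq> []" shows "x \<in> set B"
proof -
  have "first_of up (set B) \<in> set B" for up using assms(2) by (intro first_of_in) auto
  moreover have "first_of up (later up B W) \<in> set B" if "later up B W \<noteq> {}" for up
    using first_of_in[OF _ that] by (auto simp: later_def)
  ultimately show ?thesis using assms(1)
    by (auto simp: up_down_def coin_start_def split: option.splits prod.splits if_splits)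
qed

abbreviation play_ud :: "nat \<Rightarrow> nat \<Rightarrow> 'a::linorder list \<Rightarrow> 'a list \<Rightarrow> phase \<Rightarrow> 'a list pmf" where
  "play_ud m \<equiv> play (up_down m)"

lemma play_ud_step:
  assumes "distinct I" "feasible n I W" "length W < length I" "n \<ge> 1"
  shows "play_ud m n I W c =
    up_down m c (take (length W + n) I) (buffer n I W) W \<bind> (\<lambda>(x, c'). play_ud m n I (W @ [x]) c')"
  using assms buffer_eq_Nil_iff[OF assms(1,2,4)] by (intro play_step up_down_in_buffer) auto

section \<open>Each run of the algorithm is greedy\<close>

text \<open>Invariant of an unfinished greedy run. The second alternative admits elements that can
  still be appended; it disappears when no candidate is left. \<open>g\<close> is nonempty so that
  the last element of the output belongs to the run.\<close>

definition partial_run :: "bool \<Rightarrow> nat \<Rightarrow> 'a::linorder list \<Rightarrow> 'a list \<Rightarrow> 'a list \<Rightarrow> bool" where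
  "partial_run up n I W g \<longleftrightarrow> g \<noteq> [] \<and> sorted_wrt (before up) g \<and> feasible n I (W @ g) \<and>
     (\<forall>i\<le>length g. \<forall>e\<in>set (take (length W + i + n) I) - set (W @ g).
        (\<exists>k<i. before up e (g ! k)) \<or> (\<forall>z\<in>set g. before up z e))"

lemma in_buffer_iff: "e \<in> set (buffer n I W) \<longleftrightarrow> e \<in> set (take (length W + n) I) \<and> e \<notin> set W"
  by (auto simp: buffer_def)

lemma before_last_imp:
  assumes "sorted_wrt (before up) g" "g \<noteq> []" "before up (last g) e" "z \<in> set g"
  shows "before up z e"
proof (cases "z = last g")
  case False
  then have "z \<in> set (butlast g)" using assms(2,4) by (metis append_butlast_last_id in_set_conv_decomp_last rotate1.simps(2) set_ConsD set_rotate1)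
  moreover have "sorted_wrt (before up) (butlast g @ [last g])" using assms(1,2) by simp
  ultimately have "before up z (last g)" unfolding sorted_wrt_append by simp
  then show ?thesis using assms(3) before_trans by blast
qed (use assms in simp)

lemma partial_run_start:
  assumes "feasible n I W" "buffer n I W \<noteq> []"
  shows "partial_run up n I W [first_of up (set (buffer n I W))]"
proof -
  let ?x = "first_of up (set (buffer n I W))"
  have x: "?x \<in> set (buffer n I W)" using assms(2) by (intro first_of_in) auto
  have "before up ?x e" if "e \<in> set (take (length W + n) I)" "e \<notin> set (W @ [?x])" for e
    using that by (intro first_of_before) (auto simp: in_buffer_iff)
  moreover have "before up e ?x \<or> before up ?x e" if "e \<notin> set (W @ [?x])" for e
    using that by (intro before_total) auto
  ultimately show ?thesis
    using feasible_snoc[OF assms(1) x] unfolding partial_run_def by (auto simp: le_Suc_eq)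
qed

lemma partial_run_step:
  assumes g: "partial_run up n I W g" and l: "later up (buffer n I (W @ g)) (W @ g) \<noteq> {}"
  shows "partial_run up n I W (g @ [first_of up (later up (buffer n I (W @ g)) (W @ g))])"
proof -
  let ?L = "later up (buffer n I (W @ g)) (W @ g)"
  let ?x = "first_of up ?L"
  have g': "g \<noteq> []" "sorted_wrt (before up) g" "feasible n I (W @ g)" using g by (auto simp: partial_run_def)
  have fin: "finite ?L" by (simp add: later_def)
  have x: "?x \<in> ?L" using fin l by (rule first_of_in)
  have s: "sorted_wrt (before up) (g @ [?x])"
    using g' x before_last_imp[OF g'(2,1)] by (auto simp: sorted_wrt_append later_def)
  have f: "feasible n I (W @ g @ [?x])" using feasible_snoc[OF g'(3), of ?x] x by (simp add: later_def)
  have "(\<exists>k<i. before up e ((g @ [?x]) ! k)) \<or> (\<forall>z\<in>set (g @ [?x]). before up z e)"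
    if i: "i \<le> Suc (length g)" and e: "e \<in> set (take (length W + i + n) I)" "e \<notin> set (W @ g @ [?x])" for i e
  proof (cases "i = Suc (length g)")
    \<comment> \<open>Every element of \<open>g @ [?x]\<close> may now serve as the witness, so
      comparability of \<open>e\<close> with each of them suffices.\<close>
    case True
    then show ?thesis
      using e(2) before_total[of e _ up] by (metis Un_iff in_set_conv_nth length_append_singleton set_append)
  next
    case False
    then have i': "i \<le> length g" using i by simp
    then have "(\<exists>k<i. before up e (g ! k)) \<or> (\<forall>z\<in>set g. before up z e)"
      using g e unfolding partial_run_def by auto
    then show ?thesis
    proof
      assume "\<exists>k<i. before up e (g ! k)"
      then obtain k where "k < i" "before up e (g ! k)" by blast
      then have "k < i \<and> before up e ((g @ [?x]) ! k)" using i' by (simp add: nth_append)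
      then show ?thesis by blast
    next
      \<comment> \<open>An unwritten element behind all of \<open>g\<close> is a candidate, so
        choosing the foremost candidate does not overtake it.\<close>
      assume a: "\<forall>z\<in>set g. before up z e"
      have "e \<in> set (take (length (W @ g) + n) I)"
        using e(1) i' set_take_subset_set_take[of "length W + i + n" "length (W @ g) + n" I] by auto
      then have "e \<in> ?L" using a g'(1) e(2) by (auto simp: later_def in_buffer_iff)
      then have "before up ?x e" using e(2) by (intro first_of_before fin) auto
      then show ?thesis using a by auto
    qed
  qed
  then show ?thesis unfolding partial_run_def using s f by simp
qed

lemma partial_run_end:
  assumes g: "partial_run up n I W g" and l: "later up (buffer n I (W @ g)) (W @ g) = {}"
  shows "greedy_run up n I W g"
  unfolding greedy_run_def
proof (intro conjI allI impI ballI)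
  fix i e assume i: "i \<le> length g" and e: "e \<in> set (take (length W + i + n) I) - set (W @ g)"
  have "\<not> (\<forall>z\<in>set g. before up z e)"
  proof
    assume a: "\<forall>z\<in>set g. before up z e"
    have "e \<in> set (take (length (W @ g) + n) I)"
      using e i set_take_subset_set_take[of "length W + i + n" "length (W @ g) + n" I] by auto
    then have "e \<in> later up (buffer n I (W @ g)) (W @ g)"
      using a g e by (auto simp: later_def in_buffer_iff partial_run_def)
    then show False using l by simp
  qed
  then show "\<exists>k<i. before up e (g ! k)" using g i e unfolding partial_run_def by blast
qed (use g in \<open>auto simp: partial_run_def\<close>)

text \<open>While candidates remain, the rule is deterministic and keeps its state, so the play just
  continues until the run is complete; the number of unwritten elements decreases.\<close>

lemma partial_run_play:
  assumes I: "distinct I" "n \<ge> 1" and g: "partial_run up n I W g"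
  shows "\<exists>g'. greedy_run up n I W g' \<and> later up (buffer n I (W @ g')) (W @ g') = {} \<and>
    play_ud m n I (W @ g) (Some (k, j, up)) = play_ud m n I (W @ g') (Some (k, j, up))"
  using g
proof (induction "length I - length (W @ g)" arbitrary: g rule: less_induct)
  case less
  let ?L = "later up (buffer n I (W @ g)) (W @ g)"
  have f: "feasible n I (W @ g)" using less.prems by (simp add: partial_run_def)
  show ?case
  proof (cases "?L = {}")
    case True
    then show ?thesis using partial_run_end[OF less.prems] by blast
  next
    case False
    let ?x = "first_of up ?L"
    have "buffer n I (W @ g) \<noteq> []" using False by (auto simp: later_def)
    then have lt: "length (W @ g) < length I"
      using buffer_eq_Nil_iff[OF I(1) f I(2)] feasible_length_le[OF I(1) f] by simp
    have "play_ud m n I (W @ g) (Some (k, j, up)) = play_ud m n I (W @ g @ [?x]) (Some (k, j, up))"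
      using False by (subst play_ud_step[OF I(1) f lt I(2)]) (simp add: up_down_def bind_return_pmf)
    then show ?thesis
      using less.hyps[OF _ partial_run_step[OF less.prems False]] lt by simp
  qed
qed

text \<open>An exhausted input offers no first element. Treating this case here lets the remaining
  runs of a phase be empty, so that a phase cut off by the end of the input needs no separate
  analysis.\<close>

definition launch :: "nat \<Rightarrow> nat \<Rightarrow> 'a::linorder list \<Rightarrow> nat \<Rightarrow> nat \<Rightarrow> bool \<Rightarrow> 'a list \<Rightarrow> 'a list pmf" where
  "launch m n I k j up W = (if length W = length I then return_pmf W
     else play_ud m n I (W @ [first_of up (set (buffer n I W))]) (Some (k, j, up)))"

lemma launch_run:
  assumes I: "distinct I" "n \<ge> 1" and W: "feasible n I W"
  shows "\<exists>g. greedy_run up n I W g \<and> later up (buffer n I (W @ g)) (W @ g) = {} \<and>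
    launch m n I k j up W = play_ud m n I (W @ g) (Some (k, j, up))"
proof (cases "length W = length I")
  case True
  then have B: "buffer n I W = []" using buffer_eq_Nil_iff[OF I(1) W I(2)] by simp
  \<comment> \<open>For the empty run the overtaking clause concerns only the buffered elements, and
    the buffer is empty.\<close>
  then have "greedy_run up n I W []"
    using W by (auto simp: greedy_run_def buffer_def filter_empty_conv)
  then show ?thesis using True B by (intro exI[of _ "[]"]) (simp add: later_def launch_def play_done)
next
  case False
  then have "buffer n I W \<noteq> []" using buffer_eq_Nil_iff[OF I(1) W I(2)] by simp
  then show ?thesis
    using partial_run_play[OF I partial_run_start[OF W], of up m k j] False by (simp add: launch_def)
qed

lemma play_ud_None:
  assumes I: "distinct I" "n \<ge> 1" and W: "feasible n I W"
  shows "play_ud m n I W None = bernoulli_pmf (1 / 2) \<bind> (\<lambda>up. launch m n I (length W) 0 up W)"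
proof (cases "length W = length I")
  case True
  then show ?thesis by (simp add: launch_def play_done)
next
  case False
  then have "length W < length I" using feasible_length_le[OF I(1) W] by simp
  from play_ud_step[OF I(1) W this I(2), of m None] False show ?thesis
    by (simp add: up_down_def coin_start_def bind_map_pmf launch_def)
qed

lemma play_ud_run_end:
  assumes I: "distinct I" "n \<ge> 1" and W: "feasible n I W" and l: "later up (buffer n I W) W = {}"
  shows "play_ud m n I W (Some (k, j, up)) =
    (if j < 2 \<or> j = 2 \<and> \<not> covered (\<not> up) m (take (length W + n) I) (take k W) W
     then launch m n I k (Suc j) (\<not> up) W else play_ud m n I W None)"
proof (cases "length W = length I")
  case True
  then show ?thesis by (simp add: launch_def play_done)
next
  case False
  then have lt: "length W < length I" using feasible_length_le[OF I(1) W] by simp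
  have "up_down m (Some (k, j, up)) R B W = up_down m None R B W"
    if "later up B W = {}" "\<not> (j < 2 \<or> j = 2 \<and> \<not> covered (\<not> up) m R (take k W) W)" for R B
    using that by (auto simp: up_down_def)
  then show ?thesis
    using False l by (auto simp: play_ud_step[OF I(1) W lt I(2)] up_down_def launch_def bind_return_pmf)
qed

text \<open>Charges nothing for the runs of a phase that begin after the whole input is
  written.\<close>

lemma greedy_run_complete:
  assumes "distinct I" "length I \<le> length W" "greedy_run up n I W g" shows "g = []"
proof -
  have "length (W @ g) \<le> length I" using assms(1,3) by (intro feasible_length_le[of I n]) (simp_all add: greedy_run_def)
  then have "length g = 0" using assms(2) unfolding length_append by linarith
  then show ?thesis by simp
qed

section \<open>Counting runs\<close>

lemma num_runs_le: "concat rs = S \<Longrightarrow> \<forall>r\<in>set rs. is_run r \<Longrightarrow> num_runs S \<le> length rs"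
  unfolding num_runs_def by (intro Least_le) blast

lemma num_runs_decomposition: "\<exists>rs. length rs = num_runs S \<and> concat rs = S \<and> (\<forall>r\<in>set rs. is_run r)"
  unfolding num_runs_def
proof (rule LeastI_ex)
  have "concat (map (\<lambda>x. [x]) S) = S" by simp
  moreover have "\<forall>r\<in>set (map (\<lambda>x. [x]) S). is_run r" by (auto simp: is_run_def)
  ultimately show "\<exists>k rs. length rs = k \<and> concat rs = S \<and> (\<forall>r\<in>set rs. is_run r)" by blast
qed

lemma num_runs_Nil [simp]: "num_runs [] = 0"
  using num_runs_le[of "[]"] by simp

lemma num_runs_append: "num_runs (S @ T) \<le> num_runs S + num_runs T"
proof -
  obtain rs ts where "length rs = num_runs S" "concat rs = S" "\<forall>r\<in>set rs. is_run r"
    "length ts = num_runs T" "concat ts = T" "\<forall>r\<in>set ts. is_run r"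
    using num_runs_decomposition by metis
  then show ?thesis using num_runs_le[of "rs @ ts" "S @ T"] by auto
qed

lemma sorted_before_iff: "sorted_wrt (before up) r \<longleftrightarrow> distinct r \<and> (if up then sorted r else sorted (rev r))"
proof (cases up)
  case True
  then have "before up = ((<) :: 'a \<Rightarrow> 'a \<Rightarrow> bool)" by (simp add: before_def fun_eq_iff)
  then show ?thesis using True by (auto simp: strict_sorted_iff)
next
  case False
  then have "before up = (\<lambda>x y :: 'a. y < x)" by (simp add: before_def fun_eq_iff)
  then have "sorted_wrt (before up) r \<longleftrightarrow> sorted_wrt (<) (rev r)" by (simp add: sorted_wrt_rev)
  then show ?thesis using False by (auto simp: strict_sorted_iff)
qed

lemma sorted_before_is_run: "sorted_wrt (before up) r \<Longrightarrow> is_run r"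
  by (auto simp: sorted_before_iff is_run_def split: if_splits)

lemma is_run_sorted_before: "is_run r \<Longrightarrow> distinct r \<Longrightarrow> \<exists>up. sorted_wrt (before up) r"
  unfolding is_run_def sorted_before_iff by (metis (full_types))

lemma num_runs_greedy: "greedy_run up n I W g \<Longrightarrow> num_runs (W @ g) \<le> num_runs W + 1"
  using num_runs_append[of W g] num_runs_le[of "[g]" g] sorted_before_is_run[of up g] by (simp add: greedy_run_def)

lemma length_le_of_subset:
  assumes "distinct xs" "set xs \<subseteq> set ys" shows "length xs \<le> length ys"
proof -
  have "length xs = card (set xs)" using assms(1) by (simp add: distinct_card)
  also have "\<dots> \<le> card (set ys)" using assms(2) by (intro card_mono) auto
  also have "\<dots> \<le> length ys" by (rule card_length)
  finally show ?thesis .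
qed

section \<open>Cost and effect of a phase\<close>

text \<open>What the analysis needs of a phase that starts in direction \<open>up\<close>. The last
  clause treats a single optimal run left over at the end: the two outcomes of the coin then cost at
  most 1 and 2, on average 3/2.\<close>

definition serves :: "nat \<Rightarrow> 'a::linorder list \<Rightarrow> bool \<Rightarrow> 'a list \<Rightarrow> 'a list \<Rightarrow> bool" where
  "serves m I up W W' \<longleftrightarrow> set W \<subseteq> set W' \<and> num_runs W' \<le> num_runs W + 4 \<and>
     (\<forall>x r s a b. feasible m I (x @ r @ s) \<longrightarrow> set x \<subseteq> set W \<longrightarrow> sorted_wrt (before a) r \<longrightarrow>
        sorted_wrt (before b) s \<longrightarrow> set r \<union> set s \<subseteq> set W') \<and>
     (\<forall>x r a. feasible m I (x @ r) \<longrightarrow> set x \<subseteq> set W \<longrightarrow> set I \<subseteq> set (x @ r) \<longrightarrow>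
        sorted_wrt (before a) r \<longrightarrow> num_runs W' \<le> num_runs W + (if a = up then 1 else 2))"

lemma servesD:
  assumes "serves m I up W W'"
  shows "set W \<subseteq> set W'" and "num_runs W' \<le> num_runs W + 4"
    and "feasible m I (x @ r @ s) \<Longrightarrow> set x \<subseteq> set W \<Longrightarrow> sorted_wrt (before a) r \<Longrightarrow>
      sorted_wrt (before b) s \<Longrightarrow> set r \<union> set s \<subseteq> set W'"
    and "feasible m I (x @ r) \<Longrightarrow> set x \<subseteq> set W \<Longrightarrow> set I \<subseteq> set (x @ r) \<Longrightarrow>
      sorted_wrt (before a) r \<Longrightarrow> num_runs W' \<le> num_runs W + (if a = up then 1 else 2)"
  using assms unfolding serves_def by blast+

text \<open>\<open>W1\<close> to \<open>W4\<close> are the outputs after the four greedy runs. All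
  four are constructed, and the test selects \<open>W3\<close> or \<open>W4\<close> as the end of
  the phase.\<close>

lemma launch_phase:
  assumes I: "distinct I" and m: "m \<ge> 1" and W: "feasible (2 * m) I W"
  shows "\<exists>g W'. greedy_run up (2 * m) I W g \<and>
    launch m (2 * m) I (length W) 0 up W = play_ud m (2 * m) I W' None \<and> feasible (2 * m) I W' \<and>
    serves m I up W W' \<and> (lucky up m I W g \<longrightarrow> num_runs W' \<le> num_runs W + 3)"
proof -
  let ?n = "2 * m" and ?k = "length W"
  have n: "?n \<ge> 1" using m by simp
  obtain g1 where g1: "greedy_run up ?n I W g1" "later up (buffer ?n I (W @ g1)) (W @ g1) = {}"
    "launch m ?n I ?k 0 up W = play_ud m ?n I (W @ g1) (Some (?k, 0, up))"
    using launch_run[OF I n W] by blast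
  define W1 where "W1 = W @ g1"
  have W1: "feasible ?n I W1" using g1(1) by (simp add: greedy_run_def W1_def)
  obtain g2 where g2: "greedy_run (\<not> up) ?n I W1 g2" "later (\<not> up) (buffer ?n I (W1 @ g2)) (W1 @ g2) = {}"
    "launch m ?n I ?k 1 (\<not> up) W1 = play_ud m ?n I (W1 @ g2) (Some (?k, 1, \<not> up))"
    using launch_run[OF I n W1] by blast
  define W2 where "W2 = W1 @ g2"
  have W2: "feasible ?n I W2" using g2(1) by (simp add: greedy_run_def W2_def)
  obtain g3 where g3: "greedy_run up ?n I W2 g3" "later up (buffer ?n I (W2 @ g3)) (W2 @ g3) = {}"
    "launch m ?n I ?k 2 up W2 = play_ud m ?n I (W2 @ g3) (Some (?k, 2, up))"
    using launch_run[OF I n W2] by blast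
  define W3 where "W3 = W2 @ g3"
  have W3: "feasible ?n I W3" using g3(1) by (simp add: greedy_run_def W3_def)
  obtain g4 where g4: "greedy_run (\<not> up) ?n I W3 g4" "later (\<not> up) (buffer ?n I (W3 @ g4)) (W3 @ g4) = {}"
    "launch m ?n I ?k 3 (\<not> up) W3 = play_ud m ?n I (W3 @ g4) (Some (?k, 3, \<not> up))"
    using launch_run[OF I n W3] by blast
  define W4 where "W4 = W3 @ g4"
  have W4: "feasible ?n I W4" using g4(1) by (simp add: greedy_run_def W4_def)
  let ?done = "covered (\<not> up) m (take (length W3 + ?n) I) W W3"
  define W' where "W' = (if ?done then W3 else W4)"
  note folds = W1_def[symmetric] W2_def[symmetric] W3_def[symmetric] W4_def[symmetric]
  have sub: "set W \<subseteq> set W1" "set W1 \<subseteq> set W2" "set W2 \<subseteq> set W3" "set W3 \<subseteq> set W4"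
    by (auto simp: W1_def W2_def W3_def W4_def)
  have tk: "take ?k W3 = W" by (simp add: W1_def W2_def W3_def)
  have "launch m ?n I ?k 0 up W = launch m ?n I ?k 1 (\<not> up) W1"
    using g1 play_ud_run_end[OF I n W1, of up m ?k 0] by (simp add: folds)
  also have "\<dots> = launch m ?n I ?k 2 up W2"
    using g2 play_ud_run_end[OF I n W2, of "\<not> up" m ?k 1] by (simp add: folds numeral_2_eq_2)
  also have "\<dots> = (if ?done then play_ud m ?n I W3 None else launch m ?n I ?k 3 (\<not> up) W3)"
    using g3 play_ud_run_end[OF I n W3, of up m ?k 2] by (simp add: folds tk numeral_3_eq_3 numeral_2_eq_2)
  also have "launch m ?n I ?k 3 (\<not> up) W3 = play_ud m ?n I W4 None"
    using g4 play_ud_run_end[OF I n W4, of "\<not> up" m ?k 3] by (simp add: folds)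
  finally have launch: "launch m ?n I ?k 0 up W = play_ud m ?n I W' None" by (simp add: W'_def)
  have nr: "num_runs W1 \<le> num_runs W + 1" "num_runs W2 \<le> num_runs W1 + 1"
    "num_runs W3 \<le> num_runs W2 + 1" "num_runs W4 \<le> num_runs W3 + 1"
    using num_runs_greedy[OF g1(1)] num_runs_greedy[OF g2(1)] num_runs_greedy[OF g3(1)] num_runs_greedy[OF g4(1)]
    by (simp_all only: folds)
  have step: "set r \<subseteq> set V'"
    if "greedy_run a ?n I V g" "V' = V @ g" "feasible m I (x @ r)" "set x \<subseteq> set V" "sorted_wrt (before a) r"
    for a V g V' x r
  proof -
    have "set x - set V = {}" using that(4) by blast
    then show ?thesis unfolding that(2)
      by (intro greedy_run_covers[OF I that(3,5,1)]) (simp only:, simp)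
  qed
  note steps = step[OF g1(1) W1_def] step[OF g2(1) W2_def] step[OF g3(1) W3_def] step[OF g4(1) W4_def]
  have one: "set r \<subseteq> (if a = up then set W1 else set W2)"
    if "feasible m I (x @ r)" "set x \<subseteq> set W" "sorted_wrt (before a) r" for x r a
  proof (cases "a = up")
    case True
    then show ?thesis using steps(1)[OF that(1,2)] that(3) by simp
  next
    case False
    then have "a = (\<not> up)" by auto
    moreover have "set x \<subseteq> set W1" using that(2) sub(1) by (rule order.trans)
    ultimately show ?thesis using steps(2)[OF that(1)] that(3) by simp
  qed
  have two: "set r \<union> set s \<subseteq> set W'"
    if f: "feasible m I (x @ r @ s)" and x: "set x \<subseteq> set W" and s: "sorted_wrt (before a) r" "sorted_wrt (before b) s"
    for x r s a b
  proof -
    have fr: "feasible m I (x @ r)" using f feasible_appendD[of m I "x @ r" s] by simp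
    have r2: "set r \<subseteq> set W2" using one[OF fr x s(1)] sub by (auto split: if_splits)
    have fs: "feasible m I ((x @ r) @ s)" using f by simp
    have W3W': "set W3 \<subseteq> set W'" using sub by (simp add: W'_def)
    \<comment> \<open>Only two runs opposite to \<open>up\<close> can call for the fourth greedy
      run: pairs ending in \<open>up\<close> fit into the first three, and \<open>up\<close>
      followed by its opposite into the first two.\<close>
    show ?thesis
    proof (cases "b = up")
      case True
      have "set (x @ r) \<subseteq> set W2" using r2 x sub by auto
      then have "set s \<subseteq> set W3" using steps(3)[OF fs] s(2) True by simp
      then show ?thesis using r2 sub W3W' by blast
    next
      case b: False
      show ?thesis
      proof (cases "a = up")
        case True
        then have "set r \<subseteq> set W1" using one[OF fr x s(1)] by simp
        then have "set (x @ r) \<subseteq> set W1" using x sub by auto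
        moreover have "b = (\<not> up)" using b by auto
        ultimately have "set s \<subseteq> set W2" using steps(2)[OF fs] s(2) by simp
        then show ?thesis using r2 sub W3W' by blast
      next
        case a: False
        show ?thesis
        proof (cases ?done)
          case True
          have "covered (\<not> up) m I W W3" by (rule covered_takeD[OF True]) (use sub in auto)
          moreover have "a = (\<not> up)" "b = (\<not> up)" using a b by auto
          ultimately have "set r \<union> set s \<subseteq> set W3" using f x s unfolding covered_def by simp
          then show ?thesis using W3W' by (rule order.trans)
        next
          case False
          have "b = (\<not> up)" using b by auto
          moreover have "set (x @ r) \<subseteq> set W3" using r2 x sub unfolding set_append by blast
          ultimately have "set s \<subseteq> set W4" using steps(4)[OF fs] s(2) by simp
          then show ?thesis using r2 sub False by (auto simp: W'_def)
        qed
      qed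
    qed
  qed
  have lucky3: "num_runs W' \<le> num_runs W + 3" if "lucky up m I W g1"
  proof -
    \<comment> \<open>Coverage holds already after the second run.\<close>
    have "covered (\<not> up) m I W (W @ g1 @ g2)"
      by (rule lucky_covered[OF I g1(1) _ that]) (use g2(1) in \<open>simp add: W1_def\<close>)
    then have "covered (\<not> up) m I W W3"
      using sub(3) unfolding covered_def W2_def W1_def append_assoc by (blast intro: subset_trans)
    then have ?done by (rule covered_takeI)
    then show ?thesis using nr by (simp add: W'_def)
  qed
  have last: "num_runs W' \<le> num_runs W + (if a = up then 1 else 2)"
    if f: "feasible m I (x @ r)" and x: "set x \<subseteq> set W" and i: "set I \<subseteq> set (x @ r)" and s: "sorted_wrt (before a) r" for x r a
  proof -
    have 4: "g4 = []" if "set I \<subseteq> set W3" using greedy_run_complete[OF I length_le_of_subset[OF I that] g4(1)] .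
    have 3: "g3 = []" if "set I \<subseteq> set W2" using greedy_run_complete[OF I length_le_of_subset[OF I that] g3(1)] .
    have 2: "g2 = []" if "set I \<subseteq> set W1" using greedy_run_complete[OF I length_le_of_subset[OF I that] g2(1)] .
    have "set r \<subseteq> set W2" using one[OF f x s] sub(2) by (auto split: if_splits)
    then have "set I \<subseteq> set W2" using i x sub unfolding set_append by blast
    moreover from this have "set I \<subseteq> set W3" using sub(3) by blast
    \<comment> \<open>Whatever the test says, the third and fourth runs are empty.\<close>
    ultimately have "W' = W2" using 3 4 by (simp add: W'_def W3_def W4_def)
    moreover have "W2 = W1" if "a = up"
    proof -
      have "set r \<subseteq> set W1" using one[OF f x s] that by simp
      then have "set I \<subseteq> set W1" using i x sub unfolding set_append by blast
      then show ?thesis using 2 by (simp add: W2_def)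
    qed
    ultimately show ?thesis using nr by auto
  qed
  have "serves m I up W W'"
    unfolding serves_def using sub nr by (intro conjI allI impI two last) (auto simp: W'_def)
  moreover have "feasible ?n I W'" using W3 W4 by (simp add: W'_def)
  ultimately show ?thesis using g1(1) launch lucky3 by blast
qed

lemma expectation_coin:
  fixes h :: "'b \<Rightarrow> real"
  assumes "\<And>b. finite (set_pmf (f b))"
  shows "measure_pmf.expectation (bernoulli_pmf (1 / 2) \<bind> f) h =
    (measure_pmf.expectation (f True) h + measure_pmf.expectation (f False) h) / 2"
  using assms by (subst pmf_expectation_bind[of UNIV]) (auto simp: UNIV_bool)

text \<open>\<open>x\<close> is the part of an \<open>M\<close>-buffer schedule known to be written
  and \<open>rs\<close> its remaining runs; each phase consumes two of them. Letting
  \<open>W\<close> run ahead of \<open>x\<close> makes the induction hypothesis apply after a phase.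
  Finite support is carried along to split the expectation at the coin.\<close>

lemma play_ud_bounds:
  assumes I: "distinct I" and m: "m \<ge> 1"
    and "feasible m I (x @ concat rs)" "set I \<subseteq> set (x @ concat rs)" "\<forall>r\<in>set rs. is_run r"
    and "set x \<subseteq> set W" "feasible (2 * m) I W"
  shows "finite (set_pmf (play_ud m (2 * m) I W None)) \<and>
    measure_pmf.expectation (play_ud m (2 * m) I W None) (\<lambda>S. real (num_runs S))
      \<le> real (num_runs W) + 7 / 4 * real (length rs) \<and>
    (\<forall>S\<in>set_pmf (play_ud m (2 * m) I W None). num_runs S \<le> num_runs W + 2 * length rs)"
  using assms(3-)
proof (induction "length rs" arbitrary: rs x W rule: less_induct)
  case less
  let ?n = "2 * m"
  let ?P = "\<lambda>V. play_ud m ?n I V None"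
  let ?E = "\<lambda>V. measure_pmf.expectation (?P V) (\<lambda>S. real (num_runs S))"
  have n: "?n \<ge> 1" using m by simp
  have complete: "?P V = return_pmf V" if "set I \<subseteq> set V" for V
    by (rule play_done[OF length_le_of_subset[OF I that]])
  have d: "distinct (x @ concat rs)" using less.prems(1) by (simp add: feasible_def)
  have dir: "\<exists>a. sorted_wrt (before a) r" if "r \<in> set rs" for r
  proof (rule is_run_sorted_before)
    show "is_run r" using less.prems(3) that by blast
    show "distinct r" using d that by (auto simp: distinct_concat_iff)
  qed
  obtain g W1 where g: "greedy_run True ?n I W g"
    and W1: "launch m ?n I (length W) 0 True W = ?P W1" "feasible ?n I W1" "serves m I True W W1"
      "lucky True m I W g \<longrightarrow> num_runs W1 \<le> num_runs W + 3"
    using launch_phase[OF I m less.prems(5)] by blast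
  obtain h W2 where h: "greedy_run False ?n I W h"
    and W2: "launch m ?n I (length W) 0 False W = ?P W2" "feasible ?n I W2" "serves m I False W W2"
      "lucky False m I W h \<longrightarrow> num_runs W2 \<le> num_runs W + 3"
    using launch_phase[OF I m less.prems(5)] by blast
  note serve1 = servesD[OF W1(3)] and serve2 = servesD[OF W2(3)]
  have PW: "?P W = bernoulli_pmf (1 / 2) \<bind> (\<lambda>up. if up then ?P W1 else ?P W2)"
    unfolding play_ud_None[OF I n less.prems(5)] using W1(1) W2(1) by (intro bind_pmf_cong) auto
  have set_PW: "set_pmf (?P W) = set_pmf (?P W1) \<union> set_pmf (?P W2)"
    unfolding PW by (auto simp: set_pmf_bernoulli split: if_splits)
  have E: "?E W = (?E W1 + ?E W2) / 2" if "finite (set_pmf (?P W1))" "finite (set_pmf (?P W2))"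
    unfolding PW using expectation_coin[of "\<lambda>up. if up then ?P W1 else ?P W2" "\<lambda>S. real (num_runs S)"] that by simp
  show ?case
  proof (cases rs)
    case Nil
    then have "set I \<subseteq> set W" using less.prems(2,4) by auto
    then show ?thesis using Nil by (simp add: complete)
  next
    case (Cons r rs')
    show ?thesis
    proof (cases rs')
      case Nil
      then have rs: "rs = [r]" using Cons by simp
      obtain a where a: "sorted_wrt (before a) r" using dir[of r] rs by auto
      have f: "feasible m I (x @ r @ [])" "feasible m I (x @ r)" "set I \<subseteq> set (x @ r)"
        using less.prems(1,2) rs by simp_all
      have "set I \<subseteq> set W1" using serve1(3)[OF f(1) less.prems(4) a, of True] f(3) less.prems(4) serve1(1) by auto
      then have 1: "?P W1 = return_pmf W1" by (rule complete)
      have "set I \<subseteq> set W2" using serve2(3)[OF f(1) less.prems(4) a, of True] f(3) less.prems(4) serve2(1) by auto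
      then have 2: "?P W2 = return_pmf W2" by (rule complete)
      have "num_runs W1 + num_runs W2 \<le> 2 * num_runs W + 3" "num_runs W1 \<le> num_runs W + 2" "num_runs W2 \<le> num_runs W + 2"
        using serve1(4)[OF f(2) less.prems(4) f(3) a] serve2(4)[OF f(2) less.prems(4) f(3) a] by (cases a; simp)+
      moreover have "?E W = (real (num_runs W1) + real (num_runs W2)) / 2" using E by (simp add: 1 2)
      ultimately show ?thesis unfolding set_PW using rs by (simp add: 1 2)
    next
      case (Cons s ts)
      then have rs: "rs = r # s # ts" using \<open>rs = r # rs'\<close> by simp
      obtain a b where ab: "sorted_wrt (before a) r" "sorted_wrt (before b) s" using dir[of r] dir[of s] rs by auto
      have f: "feasible m I (x @ r @ s)"
        using less.prems(1) feasible_appendD[of m I "x @ r @ s" "concat ts"] rs by simp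
      have f': "feasible m I ((x @ r @ s) @ concat ts)" "set I \<subseteq> set ((x @ r @ s) @ concat ts)" "\<forall>r\<in>set ts. is_run r"
        using less.prems(1-3) rs by auto
      have lt: "length ts < length rs" using rs by simp
      have c1: "set (x @ r @ s) \<subseteq> set W1" using serve1(3)[OF f less.prems(4) ab] less.prems(4) serve1(1) by auto
      have c2: "set (x @ r @ s) \<subseteq> set W2" using serve2(3)[OF f less.prems(4) ab] less.prems(4) serve2(1) by auto
      note IH1 = less.hyps[OF lt f' c1 W1(2)] and IH2 = less.hyps[OF lt f' c2 W2(2)]
      have "lucky True m I W g \<or> lucky False m I W h"
        using lucky_either[OF I g, of h] h by simp
      \<comment> \<open>One outcome costs at most 3 runs and the other at most 4.\<close>
      then have avg: "num_runs W1 + num_runs W2 \<le> 2 * num_runs W + 7" using serve1(2) serve2(2) W1(4) W2(4) by auto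
      have "?E W = (?E W1 + ?E W2) / 2" using IH1 IH2 by (intro E) auto
      also have "\<dots> \<le> (real (num_runs W1 + num_runs W2) + 7 / 2 * real (length ts)) / 2"
        using IH1 IH2 by simp
      \<comment> \<open>The two consumed runs pay for the 7/2.\<close>
      also have "\<dots> \<le> real (num_runs W) + 7 / 4 * real (length rs)"
        using avg[folded of_nat_le_iff[where ?'a = real]] rs by (simp add: field_simps)
      finally have e: "?E W \<le> real (num_runs W) + 7 / 4 * real (length rs)" .
      moreover have "num_runs S \<le> num_runs W + 2 * length rs" if "S \<in> set_pmf (?P W)" for S
      proof -
        have "num_runs S \<le> num_runs W1 + 2 * length ts \<or> num_runs S \<le> num_runs W2 + 2 * length ts"
          using that IH1 IH2 unfolding set_PW by blast
        then show ?thesis using serve1(2) serve2(2) rs by auto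
      qed
      moreover have "finite (set_pmf (?P W))" unfolding set_PW using IH1 IH2 by simp
      ultimately show ?thesis by blast
    qed
  qed
qed

section \<open>From the buffer model to feasible sequences\<close>

lemma achievable_from_feasible:
  assumes "achievable_from B U S"
  shows "distinct (B @ U) \<Longrightarrow> distinct S \<and> set S = set (B @ U) \<and> (\<forall>i<length S. S ! i \<in> set B \<union> set (take i U))"
  using assms
proof (induction rule: achievable_from.induct)
  case (emit x B U S)
  have BU: "B \<noteq> []" "remove1 x B = filter (\<lambda>z. z \<noteq> x) B"
    using emit by (auto simp: distinct_remove1_removeAll removeAll_filter_not_eq) (metis)
  have d: "distinct (refill x B U @ drop 1 U)"
    using emit.prems by (cases U) (auto simp: refill_def BU(2))
  note IH = emit.IH[OF d]
  have set_eq: "set (refill x B U @ drop 1 U) = set (B @ U) - {x}"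
    using emit.prems emit.hyps by (cases U) (auto simp: refill_def BU(2))
  have "(x # S) ! i \<in> set B \<union> set (take i U)" if "i < length (x # S)" for i
  proof (cases i)
    case (Suc k)
    \<comment> \<open>The refill has moved the first unread element into the buffer, which turns
      index \<open>k\<close> of the tail into \<open>Suc k\<close>.\<close>
    then have "S ! k \<in> set (refill x B U) \<union> set (take k (drop 1 U))" using IH that by auto
    then show ?thesis using Suc by (cases U) (auto simp: refill_def BU(2))
  qed (use emit.hyps in simp)
  then show ?case using IH set_eq emit.hyps by auto
qed simp

lemma achievable_feasible:
  assumes "distinct I" "achievable m I S"
  shows "feasible m I S" "set S = set I"
proof -
  have "distinct (take m I @ drop m I)" using assms(1) by simp
  note * = achievable_from_feasible[OF assms(2)[unfolded achievable_def] this]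
  have "set (take m I) \<union> set (take i (drop m I)) = set (take (i + m) I)" for i
    by (metis add.commute set_append take_add)
  then show "feasible m I S" using * by (simp add: feasible_def)
  show "set S = set I" using * by simp
qed

text \<open>Writing in order of arrival is always possible, so the minimum in \<open>OPT\<close> is
  attained.\<close>

lemma achievable_from_append: "B \<noteq> [] \<or> U = [] \<Longrightarrow> achievable_from B U (B @ U)"
proof (induction "length (B @ U)" arbitrary: B U)
  case 0
  then show ?case by (simp add: achievable_from.finish)
next
  case (Suc k)
  then have "B \<noteq> []" by auto
  then obtain x B' where B: "B = x # B'" by (meson list.exhaust)
  have r: "refill x B U = B' @ take 1 U" by (simp add: refill_def B)
  have "achievable_from (B' @ take 1 U) (drop 1 U) ((B' @ take 1 U) @ drop 1 U)"
    using Suc.hyps(2) B by (intro Suc.hyps(1)) (cases U; auto)+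
  then show ?case using achievable_from.emit[of x B U "B' @ U"] unfolding r by (simp add: B)
qed

lemma OPT_witness:
  assumes "m \<ge> 1" shows "\<exists>S. achievable m I S \<and> num_runs S = OPT m I"
  unfolding OPT_def
proof (rule LeastI_ex)
  have "achievable m I I"
    using achievable_from_append[of "take m I" "drop m I"] assms by (cases I) (auto simp: achievable_def)
  then show "\<exists>k S. achievable m I S \<and> num_runs S = k" by blast
qed

theorem theorem9:
  fixes M :: nat
  assumes "M \<ge> 1"
  shows "\<exists>A :: ('a::linorder, nat) online_alg.
    writes_from_buffer A \<and>
    (\<forall>I :: 'a list. distinct I \<longrightarrow>
       measure_pmf.expectation (output_pmf A (2 * M) I) (\<lambda>S. real (num_runs S))
         \<le> 7 / 4 * real (OPT M I) \<and>
       (\<forall>S \<in> set_pmf (output_pmf A (2 * M) I). num_runs S \<le> 2 * OPT M I))"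
proof (intro exI[of _ "history_alg (up_down M)"] conjI allI impI)
  show "writes_from_buffer (history_alg (up_down M) :: ('a, nat) online_alg)"
    unfolding writes_from_buffer_def history_alg_def
    by (auto simp: Let_def case_prod_unfold intro: up_down_in_buffer)
next
  fix I :: "'a list" assume I: "distinct I"
  obtain S where S: "achievable M I S" "num_runs S = OPT M I" using OPT_witness[OF assms] by blast
  obtain rs where rs: "length rs = OPT M I" "concat rs = S" "\<forall>r\<in>set rs. is_run r"
    using num_runs_decomposition[of S] S(2) by auto
  have "feasible (2 * M) I []" by (simp add: feasible_def)
  \<comment> \<open>The induction starts with nothing written on either side and an optimal output
    cut into its \<open>OPT M I\<close> runs.\<close>
  from play_ud_bounds[OF I assms, of "[]" rs "[]"] this achievable_feasible[OF I S(1)] rs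
  have "measure_pmf.expectation (play_ud M (2 * M) I [] None) (\<lambda>S. real (num_runs S)) \<le> 7 / 4 * real (OPT M I) \<and>
    (\<forall>S\<in>set_pmf (play_ud M (2 * M) I [] None). num_runs S \<le> 2 * OPT M I)" by simp
  then show "measure_pmf.expectation (output_pmf (history_alg (up_down M)) (2 * M) I) (\<lambda>S. real (num_runs S))
      \<le> 7 / 4 * real (OPT M I)"
    and "\<forall>S\<in>set_pmf (output_pmf (history_alg (up_down M)) (2 * M) I). num_runs S \<le> 2 * OPT M I"
    unfolding output_pmf_history_alg by blast+
qed

end
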